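(* The Baire number of the subspace $\mathbf{\Sigma}\subseteq(2^{\omega_1})_\delta$ is $\omega_1$.
   Context: For a $T_1$-space $X$, the $G_\delta$-modification $(X)_\delta$ is the set $X$ endowed with the topology generated by all $G_\delta$-subsets of $X$. $2^{\omega_1}=\{0,1\}^{\omega_1}$ carries the product topology ($\{0,1\}$ discrete), and $(2^{\omega_1})_\delta$ is its $G_\delta$-modification; a base consists of the sets $[f]=\{g\in 2^{\omega_1}: f\subseteq g\}$ with $f\in 2^\alpha$, $\alpha<\omega_1$. $\mathbf{\Sigma}$ is the subspace of $(2^{\omega_1})_\delta$ consisting of all $g\in 2^{\omega_1}$ for which there is $\alpha<\omega_1$ with $g(\gamma)=0$ for all $\alpha\le\gamma<\omega_1$. The Baire number of a crowded space (a space without isolated points) $X$ is the smallest cardinality of a family of nowhere dense subsets of $X$ that covers $X$. *)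

theory Defs
  imports "HOL-Analysis.Analysis"
begin

unbundle cardinal_syntax

definition Gdelta_modification :: "'a topology \<Rightarrow> 'a topology" where
  "Gdelta_modification X = topology_generated_by {S. gdelta_in X S}"

definition crowded_space :: "'a topology \<Rightarrow> bool" where
  "crowded_space X \<longleftrightarrow> (\<forall>x\<in>topspace X. \<not> openin X {x})"

definition nowhere_dense_in :: "'a topology \<Rightarrow> 'a set \<Rightarrow> bool" where
  "nowhere_dense_in X S \<longleftrightarrow> S \<subseteq> topspace X \<and> X interior_of (X closure_of S) = {}"

definition nowhere_dense_cover :: "'a topology \<Rightarrow> 'a set set \<Rightarrow> bool" where
  "nowhere_dense_cover X \<F> \<longleftrightarrow> (\<forall>S\<in>\<F>. nowhere_dense_in X S) \<and> \<Union>\<F> = topspace X"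

text \<open>
  Cardinals are represented as in the library's theory of cardinal orders, where they are unique only
  up to order isomorphism \<open>=o\<close>: the Baire number is the cardinal of a chosen cover by nowhere
  dense sets of least cardinality. It is meaningful when such a cover exists, for instance in
  crowded \<open>T\<^sub>1\<close> spaces (lemma \<open>baire_number_least\<close> below).
\<close>

definition baire_number :: "'a topology \<Rightarrow> 'a set rel" where
  "baire_number X = card_of (SOME \<F>. nowhere_dense_cover X \<F> \<and>
     (\<forall>\<G>. nowhere_dense_cover X \<G> \<longrightarrow> |\<F>| \<le>o |\<G>| ))"

text \<open>
  The first uncountable cardinal, as a well-order relation; its elements (the countable ordinals)
  form its field, and \<open>(\<alpha>, \<gamma>) \<in> omega1\<close> means \<open>\<alpha> \<le> \<gamma> < \<omega>\<^sub>1\<close>.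
\<close>

definition omega1 :: "nat set rel" where
  "omega1 = cardSuc natLeq"

definition cantor_omega1 :: "(nat set \<Rightarrow> nat) topology" where
  "cantor_omega1 = product_topology (\<lambda>_. discrete_topology {0, 1}) (Field omega1)"

definition Sigma_omega1 :: "(nat set \<Rightarrow> nat) topology" where
  "Sigma_omega1 = subtopology (Gdelta_modification cantor_omega1)
     {g \<in> topspace cantor_omega1. \<exists>\<alpha>\<in>Field omega1. \<forall>\<gamma>. (\<alpha>, \<gamma>) \<in> omega1 \<longrightarrow> g \<gamma> = 0}"

lemma baire_number_least:
  assumes "crowded_space X" "t1_space X"
  shows "\<exists>\<F>. nowhere_dense_cover X \<F> \<and> baire_number X = |\<F>| \<and>
     (\<forall>\<G>. nowhere_dense_cover X \<G> \<longrightarrow> |\<F>| \<le>o |\<G>| )"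
proof -
  have "X interior_of (X closure_of {x}) = {}" if x: "x \<in> topspace X" for x
  proof -
    have cl: "X closure_of {x} = {x}"
      using assms(2) x by (simp add: closure_of_eq closedin_t1_singleton)
    have "openin X (X interior_of {x})" "X interior_of {x} \<subseteq> {x}"
      by (simp_all add: interior_of_subset)
    then show ?thesis
      using assms(1) x cl unfolding crowded_space_def by (metis subset_singletonD)
  qed
  then have "nowhere_dense_cover X ((\<lambda>x. {x}) ` topspace X)"
    by (auto simp: nowhere_dense_cover_def nowhere_dense_in_def)
  then have ne: "card_of ` {\<F>. nowhere_dense_cover X \<F>} \<noteq> {}"
    by blast
  have "\<forall>r\<in>card_of ` {\<F>. nowhere_dense_cover X \<F>}. Card_order r"
    by (auto simp: card_of_Card_order)
  from exists_minim_Card_order[OF ne this]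
  have "\<exists>\<F>. nowhere_dense_cover X \<F> \<and>
     (\<forall>\<G>. nowhere_dense_cover X \<G> \<longrightarrow> |\<F>| \<le>o |\<G>| )"
    by auto
  from someI_ex[OF this] show ?thesis
    unfolding baire_number_def by blast
qed

lemma openin_Gdelta_modification_cantor_omega1:
  assumes "openin (Gdelta_modification cantor_omega1) U" "f \<in> U"
  shows "\<exists>C. countable C \<and> C \<subseteq> Field omega1 \<and>
           (\<forall>g\<in>topspace cantor_omega1. (\<forall>i\<in>C. g i = f i) \<longrightarrow> g \<in> U)"
proof -
  have op: "\<exists>C. countable C \<and> C \<subseteq> Field omega1 \<and>
              (\<forall>g\<in>topspace cantor_omega1. (\<forall>i\<in>C. g i = f i) \<longrightarrow> g \<in> V)"
    if V: "openin cantor_omega1 V" "f \<in> V" for V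
  proof -
    let ?T = "\<lambda>_ :: nat set. discrete_topology {0, 1 :: nat}"
    obtain W where W: "f \<in> Pi\<^sub>E (Field omega1) W" "finite {i. W i \<noteq> topspace (?T i)}"
        "Pi\<^sub>E (Field omega1) W \<subseteq> V"
      using product_topology_open_contains_basis[OF V[unfolded cantor_omega1_def]] by blast
    let ?C = "{i. W i \<noteq> topspace (?T i)} \<inter> Field omega1"
    have "g \<in> V" if g: "g \<in> topspace cantor_omega1" "\<forall>i\<in>?C. g i = f i" for g
    proof -
      have "g i \<in> W i" if i: "i \<in> Field omega1" for i
      proof (cases "W i = topspace (?T i)")
        case True
        then show ?thesis
          using g(1) i by (auto simp: cantor_omega1_def PiE_iff)
      next
        case False
        then have "g i = f i"
          using g(2) i by blast
        then show ?thesis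
          using W(1) i by (metis PiE_mem)
      qed
      moreover have "g \<in> extensional (Field omega1)"
        using g(1) by (simp add: cantor_omega1_def PiE_iff)
      ultimately show ?thesis
        using W(3) by (meson PiE_iff subsetD)
    qed
    moreover have "countable ?C"
      using W(2) by (simp add: countable_finite)
    ultimately show ?thesis
      by (intro exI[of _ ?C]) blast
  qed
  have "generate_topology_on {S. gdelta_in cantor_omega1 S} U"
    using assms(1) unfolding Gdelta_modification_def by (rule openin_topology_generated_by)
  then show ?thesis
    using assms(2)
  proof induction
    case Empty
    then show ?case by simp
  next
    case (Int a b)
    then obtain C D where
      "countable C" "C \<subseteq> Field omega1"
      "\<forall>g\<in>topspace cantor_omega1. (\<forall>i\<in>C. g i = f i) \<longrightarrow> g \<in> a"
      "countable D" "D \<subseteq> Field omega1"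
      "\<forall>g\<in>topspace cantor_omega1. (\<forall>i\<in>D. g i = f i) \<longrightarrow> g \<in> b"
      by auto
    then show ?case
      by (intro exI[of _ "C \<union> D"]) auto
  next
    case (UN K)
    then show ?case by (meson UnionE UnionI)
  next
    case (Basis s)
    then have "gdelta_in cantor_omega1 s" by simp
    then obtain V :: "nat \<Rightarrow> (nat set \<Rightarrow> nat) set" where
      V: "\<And>n. openin cantor_omega1 (V n)" "\<Inter>(range V) = s"
      unfolding gdelta_in_descending by blast
    have "\<forall>n. \<exists>C. countable C \<and> C \<subseteq> Field omega1 \<and>
              (\<forall>g\<in>topspace cantor_omega1. (\<forall>i\<in>C. g i = f i) \<longrightarrow> g \<in> V n)"
      using op V Basis.prems by blast
    then obtain C where C: "\<And>n. countable (C n)" "\<And>n. C n \<subseteq> Field omega1"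
        "\<And>n g. g\<in>topspace cantor_omega1 \<Longrightarrow> (\<forall>i\<in>C n. g i = f i) \<Longrightarrow> g \<in> V n"
      by metis
    show ?case
    proof (intro exI[of _ "\<Union>(range C)"] conjI ballI impI)
      show "countable (\<Union>(range C))" "\<Union>(range C) \<subseteq> Field omega1"
        using C(1,2) by auto
      show "g \<in> s" if "g \<in> topspace cantor_omega1" "\<forall>i\<in>\<Union>(range C). g i = f i" for g
        using C(3)[OF that(1)] that(2) V(2) by fastforce
    qed
  qed
qed

lemma Card_order_omega1: "Card_order omega1"
  by (simp add: omega1_def cardSuc_Card_order natLeq_Card_order)

lemma uncountable_Field_omega1: "uncountable (Field omega1)"
proof
  assume "countable (Field omega1)"
  then have "|Field omega1| \<le>o natLeq"
    by (metis UNIV_I card_of_nat card_of_ordLeq countable_def ordLeq_ordIso_trans subsetI)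
  then have "omega1 \<le>o natLeq"
    using card_of_Field_ordIso[OF Card_order_omega1]
    by (meson ordIso_ordLeq_trans ordIso_symmetric)
  then show False
    using cardSuc_greater[OF natLeq_Card_order] not_ordLess_ordLeq
    unfolding omega1_def by blast
qed

lemma crowded_Sigma_omega1: "crowded_space Sigma_omega1"
  unfolding crowded_space_def
proof (intro ballI notI)
  fix f assume f: "f \<in> topspace Sigma_omega1" and "openin Sigma_omega1 {f}"
  define S where "S = {g \<in> topspace cantor_omega1.
    \<exists>\<alpha>\<in>Field omega1. \<forall>\<gamma>. (\<alpha>, \<gamma>) \<in> omega1 \<longrightarrow> g \<gamma> = 0}"
  from \<open>openin Sigma_omega1 {f}\<close> obtain U where
    U: "openin (Gdelta_modification cantor_omega1) U" "{f} = U \<inter> S"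
    unfolding Sigma_omega1_def openin_subtopology S_def by blast
  then have fS: "f \<in> S" "f \<in> U" by auto
  obtain C where C: "countable C" "C \<subseteq> Field omega1"
    "\<forall>g\<in>topspace cantor_omega1. (\<forall>i\<in>C. g i = f i) \<longrightarrow> g \<in> U"
    using openin_Gdelta_modification_cantor_omega1[OF U(1) fS(2)] by blast
  obtain i where i: "i \<in> Field omega1" "i \<notin> C"
    using C uncountable_Field_omega1 by (metis countable_subset subsetI)
  obtain \<alpha> where \<alpha>: "\<alpha> \<in> Field omega1" "\<And>\<gamma>. (\<alpha>, \<gamma>) \<in> omega1 \<Longrightarrow> f \<gamma> = 0"
    using fS(1) unfolding S_def by blast
  have inf: "infinite (Field omega1)"
    using uncountable_Field_omega1 countable_finite by blast
  obtain j where j: "j \<in> Field omega1" "i \<noteq> j" "(i, j) \<in> omega1"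
    using infinite_Card_order_limit[OF Card_order_omega1 inf i(1)] by blast
  have wo: "Well_order omega1"
    using Card_order_omega1 by (simp add: card_order_on_def)
  then have tr: "trans omega1" and an: "antisym omega1" and tot: "total_on (Field omega1) omega1"
    and re: "refl_on (Field omega1) omega1"
    by (auto simp: well_order_on_def linear_order_on_def partial_order_on_def preorder_on_def)
  obtain k where k: "k \<in> Field omega1" "(\<alpha>, k) \<in> omega1" "(j, k) \<in> omega1"
    using tot \<alpha>(1) j(1) re by (metis refl_onD total_on_def)
  define g where "g = f(i := 1 - f i)"
  have gt: "g \<in> topspace cantor_omega1"
    using fS(1) i(1) by (auto simp: S_def g_def cantor_omega1_def PiE_iff extensional_def)
  have "g \<gamma> = 0" if "(k, \<gamma>) \<in> omega1" for \<gamma>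
  proof -
    have "(\<alpha>, \<gamma>) \<in> omega1" "(j, \<gamma>) \<in> omega1"
      using that k tr by (blast dest: transD)+
    moreover from this have "\<gamma> \<noteq> i"
      using j an by (auto dest: antisymD)
    ultimately show ?thesis
      using \<alpha>(2) by (simp add: g_def)
  qed
  then have "g \<in> S"
    using gt k(1) unfolding S_def by blast
  moreover have "g \<in> U"
    using C(3) gt i(2) by (metis fun_upd_other g_def)
  ultimately have "g = f"
    using U(2) by blast
  then have "1 - f i = f i"
    by (metis fun_upd_same g_def)
  then show False by presburger
qed

end

(* The sets of points vanishing from alpha on are closed with empty interior, and there are omega1
   of them. Conversely, given countably many nowhere dense sets, one builds an increasing sequence of
   countable partial functions, the n-th step avoiding the n-th set. Their union is a partial function
   with countable, hence bounded, domain; extended by 0 it is a point of Sigma outside all the sets. *)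
theory Submission
  imports Defs "HOL-Library.Countable_Set_Type"
begin

section \<open>Cylinders over countable sets of coordinates\<close>

lemma topspace_Gdelta_modification [simp]:
  "topspace (Gdelta_modification X) = topspace X"
proof -
  have "gdelta_in X (topspace X)"
    by (simp add: open_imp_gdelta_in)
  then have "\<Union>{S. gdelta_in X S} = topspace X"
    using gdelta_in_subset by fastforce
  then show ?thesis
    unfolding Gdelta_modification_def by (simp only: topology_generated_by_topspace)
qed

lemma openin_Gdelta_modificationI:
  "gdelta_in X S \<Longrightarrow> openin (Gdelta_modification X) S"
  by (simp add: Gdelta_modification_def topology_generated_by_Basis)

lemma openin_cantor_omega1_coordinate:
  assumes "i \<in> Field omega1"
  shows "openin cantor_omega1 {g \<in> topspace cantor_omega1. g i = a}"
proof -
  have "continuous_map cantor_omega1 (discrete_topology {0, 1}) (\<lambda>g. g i)"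
    unfolding cantor_omega1_def using assms by (rule continuous_map_product_projection)
  \<comment> \<open>The value \<open>a\<close> is arbitrary; cutting it down to
    \<open>{0, 1}\<close> gives a subset of the discrete factor, hence an open set.\<close>
  moreover have "openin (discrete_topology {0, 1}) ({0, 1} \<inter> {a})"
    by simp
  ultimately have "openin cantor_omega1 {g \<in> topspace cantor_omega1. g i \<in> {0, 1} \<inter> {a}}"
    by (rule openin_continuous_map_preimage)
  moreover have "{g \<in> topspace cantor_omega1. g i \<in> {0, 1} \<inter> {a}} =
      {g \<in> topspace cantor_omega1. g i = a}"
    using assms by (auto simp: cantor_omega1_def PiE_iff)
  ultimately show ?thesis by simp
qed

lemma openin_Gdelta_cantor_omega1_cylinder:
  assumes "countable C" "C \<subseteq> Field omega1"
  shows "openin (Gdelta_modification cantor_omega1)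
    {g \<in> topspace cantor_omega1. \<forall>i\<in>C. g i = f i}"
proof -
  \<comment> \<open>Inserting the whole space keeps the family nonempty, and its intersection inside
    the space, when \<open>C\<close> is empty.\<close>
  let ?F = "insert (topspace cantor_omega1)
    ((\<lambda>i. {g \<in> topspace cantor_omega1. g i = f i}) ` C)"
  have "gdelta_in cantor_omega1 (\<Inter>?F)"
  proof (rule gdelta_in_Inter)
    fix S assume "S \<in> ?F"
    then show "gdelta_in cantor_omega1 S"
      using assms(2) openin_cantor_omega1_coordinate
      by (auto intro!: open_imp_gdelta_in)
  qed (use assms(1) in auto)
  moreover have "\<Inter>?F = {g \<in> topspace cantor_omega1. \<forall>i\<in>C. g i = f i}"
    by auto
  ultimately show ?thesis
    by (simp add: openin_Gdelta_modificationI)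
qed

lemma topspace_Sigma_omega1:
  "topspace Sigma_omega1 = {g \<in> topspace cantor_omega1.
     \<exists>\<alpha>\<in>Field omega1. \<forall>\<gamma>. (\<alpha>, \<gamma>) \<in> omega1 \<longrightarrow> g \<gamma> = 0}"
  by (auto simp: Sigma_omega1_def)

lemma openin_Sigma_omega1_cylinder:
  assumes "countable C" "C \<subseteq> Field omega1"
  shows "openin Sigma_omega1 {g \<in> topspace Sigma_omega1. \<forall>i\<in>C. g i = f i}"
proof -
  have "{g \<in> topspace Sigma_omega1. \<forall>i\<in>C. g i = f i} =
      {g \<in> topspace cantor_omega1. \<forall>i\<in>C. g i = f i} \<inter> topspace Sigma_omega1"
    by (auto simp: topspace_Sigma_omega1)
  then show ?thesis
    using openin_Gdelta_cantor_omega1_cylinder[OF assms, of f]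
    unfolding topspace_Sigma_omega1 unfolding Sigma_omega1_def openin_subtopology by blast
qed

text \<open>With the openness of cylinders this gives a neighbourhood base, so every topological
  argument below concerns countably many coordinates.\<close>

lemma openin_Sigma_omega1_contains_cylinder:
  assumes "openin Sigma_omega1 U" "f \<in> U"
  obtains C where "countable C" "C \<subseteq> Field omega1"
    "\<And>g. g \<in> topspace Sigma_omega1 \<Longrightarrow> (\<forall>i\<in>C. g i = f i) \<Longrightarrow> g \<in> U"
proof -
  obtain V where V: "openin (Gdelta_modification cantor_omega1) V"
      "U = V \<inter> topspace Sigma_omega1"
    using assms(1) unfolding topspace_Sigma_omega1
    unfolding Sigma_omega1_def openin_subtopology by blast
  show ?thesis
    using openin_Gdelta_modification_cantor_omega1[OF V(1), of f] assms(2) V(2) that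
    by (auto simp: topspace_Sigma_omega1)
qed

text \<open>Lets \<open>baire_number_least\<close> apply. Distinct points are extensional, so they
  differ at a coordinate in \<open>Field omega1\<close>, and a one-coordinate cylinder separates
  them.\<close>

lemma t1_space_Sigma_omega1: "t1_space Sigma_omega1"
  unfolding t1_space_def
proof (intro ballI impI)
  fix f g assume fg: "f \<in> topspace Sigma_omega1" "g \<in> topspace Sigma_omega1" "f \<noteq> g"
  then have "f \<in> extensional (Field omega1)" "g \<in> extensional (Field omega1)"
    by (auto simp: topspace_Sigma_omega1 cantor_omega1_def PiE_iff)
  then obtain i where i: "i \<in> Field omega1" "f i \<noteq> g i"
    using fg(3) by (meson extensionalityI)
  then show "\<exists>U. openin Sigma_omega1 U \<and> f \<in> U \<and> g \<notin> U"
    using openin_Sigma_omega1_cylinder[of "{i}" f] fg(1)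
    by (intro exI[of _ "{g \<in> topspace Sigma_omega1. \<forall>i\<in>{i}. g i = f i}"]) auto
qed

section \<open>Countable sets in \<open>omega1\<close>\<close>

lemma not_in_underS_omega1:
  assumes "\<alpha> \<in> Field omega1" "\<gamma> \<in> Field omega1" "\<gamma> \<notin> underS omega1 \<alpha>"
  shows "(\<alpha>, \<gamma>) \<in> omega1"
proof -
  have "Well_order omega1"
    using Card_order_omega1 by (simp add: card_order_on_def)
  then have "refl_on (Field omega1) omega1" "total_on (Field omega1) omega1"
    by (auto simp: well_order_on_def linear_order_on_def partial_order_on_def preorder_on_def)
  moreover have "\<gamma> = \<alpha> \<or> (\<gamma>, \<alpha>) \<notin> omega1"
    using assms(3) by (auto simp: underS_def)
  ultimately show ?thesis
    using assms(1,2) by (metis refl_onD total_on_def)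
qed

text \<open>A proper initial segment of a cardinal is smaller than it, and below the successor of
  \<open>natLeq\<close> this means at most \<open>natLeq\<close>.\<close>

lemma countable_underS_omega1: "countable (underS omega1 a)"
proof (cases "a \<in> Field omega1")
  case True
  then have "|underS omega1 a| <o omega1"
    using card_of_underS[OF Card_order_omega1] by blast
  then have "|underS omega1 a| \<le>o natLeq"
    unfolding omega1_def
    using cardSuc_ordLeq_ordLess[OF natLeq_Card_order card_of_Card_order] by blast
  then show ?thesis
    by (simp add: countable_card_le_natLeq)
next
  case False
  then show ?thesis
    by (metis countable_empty underS_empty)
qed

text \<open>Regularity: if \<open>C\<close> were unbounded, its points and the countable segments
  below them would exhaust the uncountable field.\<close>

lemma countable_omega1_bounded:
  assumes "countable C"
  obtains \<alpha> where "\<alpha> \<in> Field omega1" "\<And>\<gamma>. (\<alpha>, \<gamma>) \<in> omega1 \<Longrightarrow> \<gamma> \<notin> C"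
proof -
  have "\<exists>\<alpha>\<in>Field omega1. \<forall>\<gamma>. (\<alpha>, \<gamma>) \<in> omega1 \<longrightarrow> \<gamma> \<notin> C"
  proof (rule ccontr)
    assume "\<not> ?thesis"
    then have "Field omega1 \<subseteq> C \<union> (\<Union>c\<in>C. underS omega1 c)"
      unfolding underS_def by blast
    moreover have "countable (C \<union> (\<Union>c\<in>C. underS omega1 c))"
      using assms countable_underS_omega1 by auto
    ultimately show False
      using uncountable_Field_omega1 countable_subset by blast
  qed
  then show ?thesis
    using that by blast
qed

section \<open>Lower bound: countably many nowhere dense sets do not cover\<close>

text \<open>One extension step, from the partial function \<open>h\<close> on \<open>C\<close> to
  \<open>h'\<close> on \<open>D\<close>. The cylinder of the former is open and nonempty, so the
  closure of \<open>S\<close> omits some \<open>h'\<close> in it; \<open>D\<close> adds to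
  \<open>C\<close> the support of a cylinder around \<open>h'\<close> that misses this
  closure.\<close>

lemma Sigma_omega1_avoid_nowhere_dense:
  assumes S: "nowhere_dense_in Sigma_omega1 S" and h: "h \<in> topspace Sigma_omega1"
    and C: "countable C" "C \<subseteq> Field omega1"
  obtains h' D where "h' \<in> topspace Sigma_omega1" "countable D" "D \<subseteq> Field omega1" "C \<subseteq> D"
    "\<And>i. i \<in> C \<Longrightarrow> h' i = h i"
    "\<And>g. g \<in> topspace Sigma_omega1 \<Longrightarrow> (\<forall>i\<in>D. g i = h' i) \<Longrightarrow> g \<notin> S"
proof -
  let ?N = "{g \<in> topspace Sigma_omega1. \<forall>i\<in>C. g i = h i}"
  have "\<not> ?N \<subseteq> Sigma_omega1 closure_of S"
  proof
    assume "?N \<subseteq> Sigma_omega1 closure_of S"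
    then have "?N \<subseteq> Sigma_omega1 interior_of (Sigma_omega1 closure_of S)"
      using openin_Sigma_omega1_cylinder[OF C] by (rule interior_of_maximal)
    then show False
      using S h unfolding nowhere_dense_in_def by blast
  qed
  then obtain h' where h': "h' \<in> ?N" "h' \<notin> Sigma_omega1 closure_of S"
    by blast
  have "openin Sigma_omega1 (topspace Sigma_omega1 - Sigma_omega1 closure_of S)"
    by (simp add: openin_diff)
  then obtain E where E: "countable E" "E \<subseteq> Field omega1"
      "\<And>g. g \<in> topspace Sigma_omega1 \<Longrightarrow> (\<forall>i\<in>E. g i = h' i) \<Longrightarrow>
        g \<in> topspace Sigma_omega1 - Sigma_omega1 closure_of S"
    using openin_Sigma_omega1_contains_cylinder[of _ h'] h' by blast
  have "S \<subseteq> Sigma_omega1 closure_of S"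
    using S by (simp add: nowhere_dense_in_def closure_of_subset)
  with E C h' show ?thesis
    by (intro that[of h' "C \<union> E"]) auto
qed

lemma nowhere_dense_sequence_not_cover_Sigma_omega1:
  fixes F :: "nat \<Rightarrow> (nat set \<Rightarrow> nat) set"
  assumes F: "\<And>n. nowhere_dense_in Sigma_omega1 (F n)"
  shows "\<exists>g\<in>topspace Sigma_omega1. \<forall>n. g \<notin> F n"
proof -
  \<comment> \<open>A pair \<open>(h, C)\<close> encodes the restriction of \<open>h\<close> to
    \<open>C\<close>; values of \<open>h\<close> off \<open>C\<close> are provisional and may change
    at later stages.\<close>
  define P where "P = (\<lambda>(h, C). h \<in> topspace Sigma_omega1 \<and> countable C \<and> C \<subseteq> Field omega1)"
  define Q where "Q = (\<lambda>n (h :: nat set \<Rightarrow> nat, C) (h', D). C \<subseteq> D \<and> (\<forall>i\<in>C. h' i = h i) \<and>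
      (\<forall>g\<in>topspace Sigma_omega1. (\<forall>i\<in>D. g i = h' i) \<longrightarrow> g \<notin> F n))"
  have Field_ne: "Field omega1 \<noteq> {}"
    using uncountable_Field_omega1 by auto
  have "P ((\<lambda>i\<in>Field omega1. 0), {})"
    using Field_ne by (auto simp: P_def topspace_Sigma_omega1 cantor_omega1_def FieldI2)
  moreover have "\<exists>y. P y \<and> Q n x y" if Px: "P x" for n x
  proof -
    obtain h C where x: "x = (h, C)" "h \<in> topspace Sigma_omega1" "countable C" "C \<subseteq> Field omega1"
      using Px unfolding P_def by auto
    show ?thesis
      using Sigma_omega1_avoid_nowhere_dense[OF F x(2-4), of n]
      unfolding x(1) P_def Q_def by (simp add: split_paired_Ex) metis
  qed
  ultimately obtain s where s: "\<And>n. P (s n)" "\<And>n. Q n (s n) (s (Suc n))"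
    using dependent_nat_choice[of "\<lambda>_. P" Q] by metis
  define h where "h = (\<lambda>n. fst (s n))"
  define C where "C = (\<lambda>n. snd (s n))"
  have h: "h n \<in> topspace Sigma_omega1" and C: "countable (C n)" "C n \<subseteq> Field omega1" for n
    using s(1)[of n] by (auto simp: P_def h_def C_def split_beta)
  have step: "C n \<subseteq> C (Suc n)" "\<And>i. i \<in> C n \<Longrightarrow> h (Suc n) i = h n i"
      "\<And>g. g \<in> topspace Sigma_omega1 \<Longrightarrow> (\<forall>i\<in>C (Suc n). g i = h (Suc n) i) \<Longrightarrow> g \<notin> F n" for n
    using s(2)[of n] by (auto simp: Q_def h_def C_def split_beta)
  have coherent: "C m \<subseteq> C n \<and> (\<forall>i\<in>C m. h n i = h m i)" if "m \<le> n" for m n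
    using that by (induction rule: dec_induct) (use step in \<open>auto simp: subset_iff\<close>)
  \<comment> \<open>The first stage that fixes coordinate \<open>i\<close> supplies its value; by
    \<open>coherent\<close> all later stages agree with it.\<close>
  define g where "g = (\<lambda>i\<in>Field omega1. if i \<in> (\<Union>n. C n) then h (LEAST n. i \<in> C n) i else 0)"
  have g_eq: "g i = h n i" if "i \<in> C n" for i n
  proof -
    have "i \<in> C (LEAST n. i \<in> C n)" "(LEAST n. i \<in> C n) \<le> n"
      using that by (auto intro: LeastI Least_le)
    with coherent have "h n i = h (LEAST n. i \<in> C n) i"
      by blast
    then show ?thesis
      using that C(2) by (auto simp: g_def)
  qed
  have "h n i \<in> {0, 1}" if "i \<in> Field omega1" for n i
    using h[of n] that by (auto simp: topspace_Sigma_omega1 cantor_omega1_def PiE_iff)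
  then have "g \<in> topspace cantor_omega1"
    by (auto simp: g_def cantor_omega1_def)
  \<comment> \<open>The union of the domains is still countable, hence bounded; the default value 0
    beyond the bound puts \<open>g\<close> into \<open>Sigma_omega1\<close>.\<close>
  moreover obtain \<alpha> where "\<alpha> \<in> Field omega1"
      "\<And>\<gamma>. (\<alpha>, \<gamma>) \<in> omega1 \<Longrightarrow> \<gamma> \<notin> (\<Union>n. C n)"
    using countable_omega1_bounded[of "\<Union>n. C n"] C(1) by auto
  then have "\<exists>\<alpha>\<in>Field omega1. \<forall>\<gamma>. (\<alpha>, \<gamma>) \<in> omega1 \<longrightarrow> g \<gamma> = 0"
    by (auto simp: g_def FieldI2)
  ultimately have "g \<in> topspace Sigma_omega1"
    by (simp add: topspace_Sigma_omega1)
  \<comment> \<open>Stage \<open>Suc n\<close> is the one that avoids \<open>F n\<close>, and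
    \<open>g\<close> agrees with it on its domain.\<close>
  moreover from this have "g \<notin> F n" for n
    using step(3) g_eq by blast
  ultimately show ?thesis
    by blast
qed

lemma uncountable_nowhere_dense_cover_Sigma_omega1:
  assumes "nowhere_dense_cover Sigma_omega1 \<F>"
  shows "uncountable \<F>"
proof
  assume "countable \<F>"
  \<comment> \<open>Adding the nowhere dense set \<open>{}\<close> makes the family nonempty, so
    that it can be enumerated by all naturals.\<close>
  have nd: "nowhere_dense_in Sigma_omega1 S" if "S \<in> insert {} \<F>" for S
    using assms that by (auto simp: nowhere_dense_cover_def nowhere_dense_in_def)
  have "range (from_nat_into (insert {} \<F>)) = insert {} \<F>"
    using \<open>countable \<F>\<close> by (simp add: range_from_nat_into)
  then obtain F :: "nat \<Rightarrow> (nat set \<Rightarrow> nat) set" where F: "range F = insert {} \<F>"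
    by blast
  have "nowhere_dense_in Sigma_omega1 (F n)" for n
    using nd F rangeI[of F n] by simp
  then obtain g where "g \<in> topspace Sigma_omega1" "g \<notin> \<Union>(range F)"
    using nowhere_dense_sequence_not_cover_Sigma_omega1[of F] by auto
  then show False
    using assms unfolding F nowhere_dense_cover_def by auto
qed

section \<open>Upper bound: a cover indexed by \<open>Field omega1\<close>\<close>

text \<open>A single nonzero coordinate from \<alpha> on witnesses lying outside, so the set is
  closed. Its interior is empty because a cylinder leaves some coordinate from \<alpha> on
  free.\<close>

lemma nowhere_dense_Sigma_omega1_vanishing_above:
  assumes \<alpha>: "\<alpha> \<in> Field omega1"
  shows "nowhere_dense_in Sigma_omega1
    {g \<in> topspace Sigma_omega1. \<forall>\<gamma>. (\<alpha>, \<gamma>) \<in> omega1 \<longrightarrow> g \<gamma> = 0}"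
    (is "nowhere_dense_in _ ?Z")
proof -
  have "\<exists>T. openin Sigma_omega1 T \<and> f \<in> T \<and> T \<subseteq> topspace Sigma_omega1 - ?Z"
    if "f \<in> topspace Sigma_omega1 - ?Z" for f
  proof -
    obtain \<gamma> where "(\<alpha>, \<gamma>) \<in> omega1" "f \<gamma> \<noteq> 0"
      using \<open>f \<in> topspace Sigma_omega1 - ?Z\<close> by blast
    then show ?thesis
      using \<open>f \<in> topspace Sigma_omega1 - ?Z\<close> openin_Sigma_omega1_cylinder[of "{\<gamma>}" f]
      by (intro exI[of _ "{g \<in> topspace Sigma_omega1. \<forall>i\<in>{\<gamma>}. g i = f i}"])
        (auto simp: FieldI2)
  qed
  then have "openin Sigma_omega1 (topspace Sigma_omega1 - ?Z)"
    by (subst openin_subopen) blast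
  then have "closedin Sigma_omega1 ?Z"
    by (simp add: closedin_def)
  then have closure: "Sigma_omega1 closure_of ?Z = ?Z"
    by (simp add: closure_of_eq)
  have "False" if f: "f \<in> Sigma_omega1 interior_of ?Z" for f
  proof -
    obtain C where C: "countable C" "C \<subseteq> Field omega1"
        "\<And>g. g \<in> topspace Sigma_omega1 \<Longrightarrow> (\<forall>i\<in>C. g i = f i) \<Longrightarrow> g \<in> Sigma_omega1 interior_of ?Z"
      by (rule openin_Sigma_omega1_contains_cylinder[OF openin_interior_of f]) blast
    have fZ: "f \<in> ?Z"
      by (rule subsetD[OF interior_of_subset f])
    \<comment> \<open>The coordinate to be changed must be free in the cylinder and not below
      \<alpha>; only countably many are excluded.\<close>
    have "uncountable (Field omega1 - (C \<union> underS omega1 \<alpha>))"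
      using C(1) countable_underS_omega1 uncountable_Field_omega1
      by (simp add: uncountable_minus_countable)
    then obtain i where i: "i \<in> Field omega1" "i \<notin> C" "i \<notin> underS omega1 \<alpha>"
      by (metis Diff_iff UnCI all_not_in_conv countable_empty)
    have \<alpha>i: "(\<alpha>, i) \<in> omega1"
      using i \<alpha> by (simp add: not_in_underS_omega1)
    define g where "g = f(i := 1)"
    \<comment> \<open>Past \<beta> every index is at least \<alpha> and differs from
      \<open>i\<close>, so \<open>g\<close> vanishes there as \<open>f\<close> does and stays in
      \<open>Sigma_omega1\<close>.\<close>
    obtain \<beta> where \<beta>: "\<beta> \<in> Field omega1" "\<And>\<gamma>. (\<beta>, \<gamma>) \<in> omega1 \<Longrightarrow> \<gamma> \<notin> {i} \<union> underS omega1 \<alpha>"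
      using countable_omega1_bounded[of "{i} \<union> underS omega1 \<alpha>"] countable_underS_omega1 by auto
    have "g \<gamma> = 0" if \<gamma>: "(\<beta>, \<gamma>) \<in> omega1" for \<gamma>
    proof -
      have "\<gamma> \<noteq> i" "\<gamma> \<notin> underS omega1 \<alpha>" "\<gamma> \<in> Field omega1"
        using \<beta>(2)[OF \<gamma>] \<gamma> by (auto simp: FieldI2)
      then have "(\<alpha>, \<gamma>) \<in> omega1"
        using \<alpha> by (simp add: not_in_underS_omega1)
      then show ?thesis
        using fZ \<open>\<gamma> \<noteq> i\<close> by (simp add: g_def)
    qed
    moreover have "g \<in> topspace cantor_omega1"
      using fZ i(1)
      by (auto simp: g_def topspace_Sigma_omega1 cantor_omega1_def PiE_iff extensional_def)
    ultimately have "g \<in> topspace Sigma_omega1"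
      using \<beta>(1) by (auto simp: topspace_Sigma_omega1)
    moreover have "\<forall>j\<in>C. g j = f j"
      using i(2) by (auto simp: g_def)
    ultimately have "g \<in> ?Z"
      by (rule subsetD[OF interior_of_subset C(3)])
    then show False
      using \<alpha>i by (auto simp: g_def)
  qed
  then have "Sigma_omega1 interior_of ?Z = {}"
    by blast
  then show ?thesis
    unfolding nowhere_dense_in_def closure by auto
qed

theorem proposition8:
  shows "baire_number Sigma_omega1 =o omega1"
proof -
  obtain \<F> where \<F>: "nowhere_dense_cover Sigma_omega1 \<F>" "baire_number Sigma_omega1 = |\<F>|"
      "\<And>\<G>. nowhere_dense_cover Sigma_omega1 \<G> \<Longrightarrow> |\<F>| \<le>o |\<G>|"
    using baire_number_least[OF crowded_Sigma_omega1 t1_space_Sigma_omega1] by blast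
  define Z where "Z = (\<lambda>\<alpha>. {g \<in> topspace Sigma_omega1. \<forall>\<gamma>. (\<alpha>, \<gamma>) \<in> omega1 \<longrightarrow> g \<gamma> = 0})"
  have "\<Union>(Z ` Field omega1) = topspace Sigma_omega1"
    by (auto simp: Z_def topspace_Sigma_omega1)
  then have "nowhere_dense_cover Sigma_omega1 (Z ` Field omega1)"
    using nowhere_dense_Sigma_omega1_vanishing_above
    by (auto simp: nowhere_dense_cover_def Z_def)
  then have "|\<F>| \<le>o |Field omega1|"
    using \<F>(3) card_of_image ordLeq_transitive by blast
  then have upper: "|\<F>| \<le>o omega1"
    using card_of_Field_ordIso[OF Card_order_omega1] ordLeq_ordIso_trans by blast
  \<comment> \<open>An uncountable cardinal exceeds \<open>natLeq\<close>, hence is at least its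
    successor \<open>omega1\<close>.\<close>
  have "\<not> |\<F>| \<le>o natLeq"
    using uncountable_nowhere_dense_cover_Sigma_omega1[OF \<F>(1)]
    by (simp add: countable_card_le_natLeq)
  then have "natLeq <o |\<F>|"
    using not_ordLeq_iff_ordLess card_of_Well_order natLeq_Well_order by blast
  then have "omega1 \<le>o |\<F>|"
    unfolding omega1_def by (simp add: cardSuc_least natLeq_Card_order card_of_Card_order)
  with upper show ?thesis
    unfolding \<F>(2) by (simp add: ordIso_iff_ordLeq)
qed

end
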